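(* Let $\Lambda\mathrm{M}:=\{(\lambda,\mu)\in\mathbb{R}^2:0<\mu<\lambda\}$ and $\Lambda\mathrm{M}_{\mathrm{theory}}:=\Lambda\mathrm{M}_{\mathrm I}\cup\Lambda\mathrm{M}_{\mathrm{II}}\cup\Lambda\mathrm{M}_{\mathrm{III}}\cup\Lambda\mathrm{M}_{\mathrm{IV}}\cup\Lambda\mathrm{M}_{\mathrm V}$. Then the region $\Lambda\mathrm{M}\setminus\Lambda\mathrm{M}_{\mathrm{theory}}$ is bounded and is contained in $$\Lambda\mathrm{M}_{\mathrm{comp}}:=\left\{(\lambda,\mu):\tfrac52\le\lambda\le150,\ 0\le\mu\le\tfrac{22}{25}\lambda\right\}.$$
   Context: The regions are the following subsets of $\Lambda\mathrm{M}$. $\Lambda\mathrm{M}_{\mathrm I}:=\{0<\mu<\lambda\le2\sqrt2\}\cup\{\lambda>2\sqrt2,\ \sqrt{\lambda^2-8}\le\mu<\lambda\}$. $\Lambda\mathrm{M}_{\mathrm{II}}:=\{\lambda>0,\ \zeta_{\mathrm{II}}(\lambda)<\mu<\lambda\}$, where with $r_0=0$, $r_1=\frac23$, $r_2=\frac45$, $r_3=\frac{17}{20}$, $r_4=\frac{22}{25}$, $r_5=1$, $$\zeta_{\mathrm{II}}(\lambda):=\begin{cases}\lambda-\frac{i\pi}{2\lambda}\left(\sqrt{4\lambda^2+i^2\pi^2}-i\pi\right)&\text{if } i\pi\frac{\sqrt{r_{i-1}}}{1-r_{i-1}}\le\lambda<i\pi\frac{\sqrt{r_i}}{1-r_i},\quad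 i=1,\dots,5,\\ r_i\lambda&\text{if } i\pi\frac{\sqrt{r_i}}{1-r_i}\le\lambda<(i+1)\pi\frac{\sqrt{r_i}}{1-r_i},\quad i=1,\dots,4\end{cases}$$ (for $i=5$ the upper endpoint $5\pi\frac{\sqrt{r_5}}{1-r_5}$ is $+\infty$). $\Lambda\mathrm{M}_{\mathrm{III}}:=\{\lambda>10,\ 0<\mu\le\sqrt{\frac\lambda5-2}\}$. $\Lambda\mathrm{M}_{\mathrm{IV}}:=\{\lambda\ge\frac{578}{45},\ \frac{64}{225}\le\mu\le\frac\lambda{10}-1\}$. $\Lambda\mathrm{M}_{\mathrm V}:=\{\lambda>16\pi,\ \frac12(\lambda-\sqrt{\lambda(\lambda-16\pi)})<\mu<\frac12(\lambda+\sqrt{\lambda(\lambda-16\pi)})\}$. *)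

theory Defs
  imports "HOL-Analysis.Analysis"
begin

definition LM :: "(real \<times> real) set" where
  "LM = {(l, m). 0 < m \<and> m < l}"

definition LM_I :: "(real \<times> real) set" where
  "LM_I = {(l, m). 0 < m \<and> m < l \<and> l \<le> 2 * sqrt 2}
        \<union> {(l, m). l > 2 * sqrt 2 \<and> sqrt (l\<^sup>2 - 8) \<le> m \<and> m < l}"

definition r_seq :: "nat \<Rightarrow> real" where
  "r_seq i = [0, 2/3, 4/5, 17/20, 22/25, 1] ! i"

definition r_quot :: "nat \<Rightarrow> real" where
  "r_quot i = sqrt (r_seq i) / (1 - r_seq i)"

text \<open>For \<open>i = 5\<close> the upper endpoint of the curved piece is infinite; since
  \<open>r_seq 5 = 1\<close>, the value of \<open>r_quot 5\<close> would be \<open>x / 0 = 0\<close>, so that bound is dropped.\<close>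

definition curved_range :: "nat \<Rightarrow> real \<Rightarrow> bool" where
  "curved_range i l \<longleftrightarrow>
     real i * pi * r_quot (i - 1) \<le> l \<and> (i = 5 \<or> l < real i * pi * r_quot i)"

definition linear_range :: "nat \<Rightarrow> real \<Rightarrow> bool" where
  "linear_range i l \<longleftrightarrow>
     real i * pi * r_quot i \<le> l \<and> l < real (i + 1) * pi * r_quot i"

definition curved_value :: "nat \<Rightarrow> real \<Rightarrow> real" where
  "curved_value i l =
     l - (real i * pi) / (2 * l) * (sqrt (4 * l\<^sup>2 + (real i)\<^sup>2 * pi\<^sup>2) - real i * pi)"

text \<open>The nine ranges are pairwise disjoint and cover the nonnegative reals
  (see \<open>zeta_II_curved\<close>, \<open>zeta_II_linear\<close> and \<open>zeta_II_ranges_cover\<close> below), so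
  the order of the tests is immaterial and the final branch concerns negative \<open>l\<close> only.\<close>

definition zeta_II :: "real \<Rightarrow> real" where
  "zeta_II l =
    (if curved_range 1 l then curved_value 1 l
     else if linear_range 1 l then r_seq 1 * l
     else if curved_range 2 l then curved_value 2 l
     else if linear_range 2 l then r_seq 2 * l
     else if curved_range 3 l then curved_value 3 l
     else if linear_range 3 l then r_seq 3 * l
     else if curved_range 4 l then curved_value 4 l
     else if linear_range 4 l then r_seq 4 * l
     else if curved_range 5 l then curved_value 5 l
     else undefined)"

lemma r_seq_simps [simp]:
  "r_seq 0 = 0" "r_seq 1 = 2/3" "r_seq (Suc 0) = 2/3" "r_seq 2 = 4/5"
  "r_seq 3 = 17/20" "r_seq 4 = 22/25" "r_seq 5 = 1"
  by (simp_all add: r_seq_def numeral_eq_Suc)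

lemma r_quot_strict_mono:
  "r_quot 0 = 0" "0 < r_quot 1" "r_quot 1 < r_quot 2" "r_quot 2 < r_quot 3" "r_quot 3 < r_quot 4"
proof -
  have step: "sqrt a / (1 - a) < sqrt b / (1 - b)" if "0 < a" "a < b" "b < 1" for a b :: real
    using that by (intro frac_less) auto
  show "r_quot 0 = 0" "0 < r_quot 1" by (simp_all add: r_quot_def)
  show "r_quot 1 < r_quot 2" "r_quot 2 < r_quot 3" "r_quot 3 < r_quot 4"
    unfolding r_quot_def by (rule step; simp)+
qed

lemma zeta_II_range_simps:
  obtains p1 p2 p3 p4 :: real
  where "0 < p1" "p1 < p2" "p2 < p3" "p3 < p4"
    and "\<And>l. curved_range 1 l \<longleftrightarrow> 0 \<le> l \<and> l < p1"
    and "\<And>l. linear_range 1 l \<longleftrightarrow> p1 \<le> l \<and> l < 2 * p1"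
    and "\<And>l. curved_range 2 l \<longleftrightarrow> 2 * p1 \<le> l \<and> l < 2 * p2"
    and "\<And>l. linear_range 2 l \<longleftrightarrow> 2 * p2 \<le> l \<and> l < 3 * p2"
    and "\<And>l. curved_range 3 l \<longleftrightarrow> 3 * p2 \<le> l \<and> l < 3 * p3"
    and "\<And>l. linear_range 3 l \<longleftrightarrow> 3 * p3 \<le> l \<and> l < 4 * p3"
    and "\<And>l. curved_range 4 l \<longleftrightarrow> 4 * p3 \<le> l \<and> l < 4 * p4"
    and "\<And>l. linear_range 4 l \<longleftrightarrow> 4 * p4 \<le> l \<and> l < 5 * p4"
    and "\<And>l. curved_range 5 l \<longleftrightarrow> 5 * p4 \<le> l"
proof
  show "0 < pi * r_quot 1" "pi * r_quot 1 < pi * r_quot 2"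
    "pi * r_quot 2 < pi * r_quot 3" "pi * r_quot 3 < pi * r_quot 4"
    using r_quot_strict_mono by simp_all
qed (simp_all add: curved_range_def linear_range_def r_quot_strict_mono mult.assoc)

lemma atLeastAtMost_1_5: "i \<in> {1..5::nat} \<longleftrightarrow> i = 1 \<or> i = 2 \<or> i = 3 \<or> i = 4 \<or> i = 5"
  by auto

lemma atLeastAtMost_1_4: "i \<in> {1..4::nat} \<longleftrightarrow> i = 1 \<or> i = 2 \<or> i = 3 \<or> i = 4"
  by auto

lemma zeta_II_curved:
  assumes "i \<in> {1..5}" "curved_range i l"
  shows "zeta_II l = curved_value i l"
proof -
  obtain p1 p2 p3 p4 where p: "0 < p1" "p1 < p2" "p2 < p3" "p3 < (p4 :: real)"
    and R: "\<And>l. curved_range 1 l \<longleftrightarrow> 0 \<le> l \<and> l < p1"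
      "\<And>l. linear_range 1 l \<longleftrightarrow> p1 \<le> l \<and> l < 2 * p1"
      "\<And>l. curved_range 2 l \<longleftrightarrow> 2 * p1 \<le> l \<and> l < 2 * p2"
      "\<And>l. linear_range 2 l \<longleftrightarrow> 2 * p2 \<le> l \<and> l < 3 * p2"
      "\<And>l. curved_range 3 l \<longleftrightarrow> 3 * p2 \<le> l \<and> l < 3 * p3"
      "\<And>l. linear_range 3 l \<longleftrightarrow> 3 * p3 \<le> l \<and> l < 4 * p3"
      "\<And>l. curved_range 4 l \<longleftrightarrow> 4 * p3 \<le> l \<and> l < 4 * p4"
      "\<And>l. linear_range 4 l \<longleftrightarrow> 4 * p4 \<le> l \<and> l < 5 * p4"
      "\<And>l. curved_range 5 l \<longleftrightarrow> 5 * p4 \<le> l"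
    using zeta_II_range_simps by blast
  show ?thesis
    using assms p unfolding atLeastAtMost_1_5 zeta_II_def R
    by (elim disjE) (simp_all only: R, auto)
qed

lemma zeta_II_linear:
  assumes "i \<in> {1..4}" "linear_range i l"
  shows "zeta_II l = r_seq i * l"
proof -
  obtain p1 p2 p3 p4 where p: "0 < p1" "p1 < p2" "p2 < p3" "p3 < (p4 :: real)"
    and R: "\<And>l. curved_range 1 l \<longleftrightarrow> 0 \<le> l \<and> l < p1"
      "\<And>l. linear_range 1 l \<longleftrightarrow> p1 \<le> l \<and> l < 2 * p1"
      "\<And>l. curved_range 2 l \<longleftrightarrow> 2 * p1 \<le> l \<and> l < 2 * p2"
      "\<And>l. linear_range 2 l \<longleftrightarrow> 2 * p2 \<le> l \<and> l < 3 * p2"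
      "\<And>l. curved_range 3 l \<longleftrightarrow> 3 * p2 \<le> l \<and> l < 3 * p3"
      "\<And>l. linear_range 3 l \<longleftrightarrow> 3 * p3 \<le> l \<and> l < 4 * p3"
      "\<And>l. curved_range 4 l \<longleftrightarrow> 4 * p3 \<le> l \<and> l < 4 * p4"
      "\<And>l. linear_range 4 l \<longleftrightarrow> 4 * p4 \<le> l \<and> l < 5 * p4"
      "\<And>l. curved_range 5 l \<longleftrightarrow> 5 * p4 \<le> l"
    using zeta_II_range_simps by blast
  show ?thesis
    using assms p unfolding atLeastAtMost_1_4 zeta_II_def R
    by (elim disjE) (simp_all only: R, auto)
qed

lemma zeta_II_ranges_cover:
  assumes "0 \<le> l"
  shows "(\<exists>i\<in>{1..5}. curved_range i l) \<or> (\<exists>i\<in>{1..4}. linear_range i l)"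
proof (rule zeta_II_range_simps)
  fix p1 p2 p3 p4 :: real
  assume R: "\<And>l. curved_range 1 l \<longleftrightarrow> 0 \<le> l \<and> l < p1"
      "\<And>l. linear_range 1 l \<longleftrightarrow> p1 \<le> l \<and> l < 2 * p1"
      "\<And>l. curved_range 2 l \<longleftrightarrow> 2 * p1 \<le> l \<and> l < 2 * p2"
      "\<And>l. linear_range 2 l \<longleftrightarrow> 2 * p2 \<le> l \<and> l < 3 * p2"
      "\<And>l. curved_range 3 l \<longleftrightarrow> 3 * p2 \<le> l \<and> l < 3 * p3"
      "\<And>l. linear_range 3 l \<longleftrightarrow> 3 * p3 \<le> l \<and> l < 4 * p3"
      "\<And>l. curved_range 4 l \<longleftrightarrow> 4 * p3 \<le> l \<and> l < 4 * p4"
      "\<And>l. linear_range 4 l \<longleftrightarrow> 4 * p4 \<le> l \<and> l < 5 * p4"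
      "\<And>l. curved_range 5 l \<longleftrightarrow> 5 * p4 \<le> l"
  have "curved_range 1 l \<or> linear_range 1 l \<or> curved_range 2 l \<or> linear_range 2 l \<or>
    curved_range 3 l \<or> linear_range 3 l \<or> curved_range 4 l \<or> linear_range 4 l \<or> curved_range 5 l"
    unfolding R using assms by linarith
  then show ?thesis
    unfolding Bex_def atLeastAtMost_1_5 atLeastAtMost_1_4 by blast
qed

definition LM_II :: "(real \<times> real) set" where
  "LM_II = {(l, m). l > 0 \<and> zeta_II l < m \<and> m < l}"

definition LM_III :: "(real \<times> real) set" where
  "LM_III = {(l, m). l > 10 \<and> 0 < m \<and> m \<le> sqrt (l / 5 - 2)}"

definition LM_IV :: "(real \<times> real) set" where
  "LM_IV = {(l, m). l \<ge> 578 / 45 \<and> 64 / 225 \<le> m \<and> m \<le> l / 10 - 1}"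

definition LM_V :: "(real \<times> real) set" where
  "LM_V = {(l, m). l > 16 * pi
      \<and> (l - sqrt (l * (l - 16 * pi))) / 2 < m
      \<and> m < (l + sqrt (l * (l - 16 * pi))) / 2}"

definition LM_theory :: "(real \<times> real) set" where
  "LM_theory = LM_I \<union> LM_II \<union> LM_III \<union> LM_IV \<union> LM_V"

definition LM_comp :: "(real \<times> real) set" where
  "LM_comp = {(l, m). 5 / 2 \<le> l \<and> l \<le> 150 \<and> 0 \<le> m \<and> m \<le> 22 / 25 * l}"

end

theory Submission
  imports Defs
begin

text \<open>
  The curved pieces of \<^term>\<open>zeta_II\<close> are below the line \<open>\<mu> = r\<lambda>\<close> exactly up to
  \<open>\<lambda> = i\<pi>\<surd>r/(1 - r)\<close>, so \<open>\<zeta>(\<lambda>) \<le> 22\<lambda>/25\<close> until the last piece begins, near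
  \<open>\<lambda> = 122.8\<close>. Beyond that point region V, which is \<open>\<mu>(\<lambda> - \<mu>) > 4\<pi>\<lambda>\<close>,
  reaches up to distance \<open>14.3\<close> from the diagonal, where region II has already started;
  and for \<open>\<lambda> > 150\<close> its lower boundary is below \<open>\<mu> = 14\<close>, where region IV takes over.
\<close>

text \<open>With \<open>a = i * pi\<close>, the claim reads \<open>2 * l\<^sup>2 * (1 - r) / a + a
  \<le> sqrt (4 * l\<^sup>2 + a\<^sup>2)\<close>; squaring reduces it to
  \<open>l * (1 - r) \<le> a * sqrt r\<close>, which is the bound on \<open>l\<close>.\<close>

lemma curved_value_le:
  assumes "i > 0" "0 \<le> r" "r < 1" "0 < l" and l: "l \<le> real i * pi * (sqrt r / (1 - r))"
  shows "curved_value i l \<le> r * l"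
proof -
  define a where "a = real i * pi"
  have a: "a > 0" using \<open>i > 0\<close> by (simp add: a_def)
  have "l * (1 - r) \<le> a * sqrt r"
    using l \<open>r < 1\<close> by (simp add: a_def field_simps)
  then have "(l * (1 - r))\<^sup>2 \<le> (a * sqrt r)\<^sup>2"
    using assms by (intro power_mono) auto
  then have "l\<^sup>2 * (1 - r)\<^sup>2 \<le> a\<^sup>2 * r"
    using \<open>0 \<le> r\<close> by (simp add: power_mult_distrib)
  then have "4 * l\<^sup>2 * (l\<^sup>2 * (1 - r)\<^sup>2) / a\<^sup>2 \<le> 4 * l\<^sup>2 * (a\<^sup>2 * r) / a\<^sup>2"
    by (intro divide_right_mono mult_left_mono) auto
  also have "\<dots> = 4 * l\<^sup>2 * r"
    using a by simp
  finally have "(2 * l\<^sup>2 * (1 - r) / a)\<^sup>2 \<le> 4 * l\<^sup>2 * r"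
    by (simp add: power_mult_distrib power_divide power2_eq_square algebra_simps)
  moreover have "2 * (2 * l\<^sup>2 * (1 - r) / a) * a = 4 * l\<^sup>2 - 4 * l\<^sup>2 * r"
    using a by (simp add: field_simps)
  ultimately have "(2 * l\<^sup>2 * (1 - r) / a + a)\<^sup>2 \<le> 4 * l\<^sup>2 + a\<^sup>2"
    unfolding power2_sum by linarith
  then have "2 * l\<^sup>2 * (1 - r) / a + a \<le> sqrt (4 * l\<^sup>2 + a\<^sup>2)"
    by (rule real_le_rsqrt)
  then have "a / (2 * l) * (2 * l\<^sup>2 * (1 - r) / a) \<le> a / (2 * l) * (sqrt (4 * l\<^sup>2 + a\<^sup>2) - a)"
    using a \<open>0 < l\<close> by (intro mult_left_mono) auto
  moreover have "a / (2 * l) * (2 * l\<^sup>2 * (1 - r) / a) = l - r * l"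
    using a \<open>0 < l\<close> by (simp add: power2_eq_square field_simps)
  ultimately show ?thesis
    by (simp add: curved_value_def a_def power_mult_distrib)
qed

text \<open>Bounding the square root below by \<open>2 * l\<close> leaves a gap to the diagonal of
  at least \<open>5 * pi - 25 * pi\<^sup>2 / (2 * l)\<close>, which increases with \<open>l\<close>
  and is about 14.69 at \<open>l = 122\<close>.\<close>

lemma curved_value_5_less:
  assumes "l \<ge> 122"
  shows "curved_value 5 l < l - 143 / 10"
proof -
  have pi: "3.14 < pi" "pi < 3.142" using pi_approx by auto
  have "2 * l = sqrt ((2 * l)\<^sup>2)"
    unfolding real_sqrt_abs using assms by simp
  also have "\<dots> \<le> sqrt (4 * l\<^sup>2 + 5\<^sup>2 * pi\<^sup>2)"
    by (intro real_sqrt_le_mono) (simp add: power_mult_distrib)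
  finally have "5 * pi / (2 * l) * (2 * l - 5 * pi)
      \<le> 5 * pi / (2 * l) * (sqrt (4 * l\<^sup>2 + 5\<^sup>2 * pi\<^sup>2) - 5 * pi)"
    using assms by (intro mult_left_mono) auto
  moreover have "143 / 10 < 5 * pi / (2 * l) * (2 * l - 5 * pi)"
  proof -
    have "pi * pi \<le> 3142 / 1000 * (3142 / 1000)"
      using pi by (intro mult_mono) auto
    moreover have "314 / 100 * l \<le> pi * l"
      using pi assms by (intro mult_right_mono) auto
    ultimately have "143 * l < 50 * (pi * l) - 125 * (pi * pi)"
      using assms by linarith
    then show ?thesis
      using assms by (simp add: field_simps)
  qed
  ultimately show ?thesis
    by (simp add: curved_value_def)
qed

lemma zeta_II_cases:
  assumes "0 < l"
  obtains "zeta_II l \<le> 22 / 25 * l" | "l \<ge> 122" "zeta_II l = curved_value 5 l"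
proof -
  have r: "r_seq i \<le> 22 / 25" "0 \<le> r_seq i" if "i \<in> {1..4}" for i
    using that unfolding atLeastAtMost_1_4 by auto
  have "zeta_II l \<le> 22 / 25 * l \<or> l \<ge> 122 \<and> zeta_II l = curved_value 5 l"
    using zeta_II_ranges_cover[OF less_imp_le[OF assms]]
  proof (elim disjE bexE)
    fix i assume i: "i \<in> {1..4}" "linear_range i l"
    then show ?thesis
      using zeta_II_linear[OF i] mult_right_mono[OF r(1)[OF i(1)], of l] assms by simp
  next
    fix i :: nat assume i: "i \<in> {1..5}" "curved_range i l"
    show ?thesis
    proof (cases "i = 5")
      case True
      \<comment> \<open>Dividing 0.938 by 1 - 22/25 = 3/25 gives more than 7.81, and 5 * 3.14 * 7.81
        exceeds 122.\<close>
      have "0.938 \<le> sqrt (22 / 25)"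
        by (rule real_le_rsqrt) (simp add: power2_eq_square)
      then have "7.81 \<le> r_quot 4"
        by (simp add: r_quot_def)
      then have "5 * 3.14 * 7.81 \<le> 5 * pi * r_quot 4"
        using pi_approx by (intro mult_mono) auto
      moreover have "5 * pi * r_quot 4 \<le> l"
        using i True by (simp add: curved_range_def)
      ultimately show ?thesis
        using zeta_II_curved[OF i] True by simp
    next
      case False
      then have i4: "i \<in> {1..4}" using i by auto
      \<comment> \<open>The range of piece \<open>i\<close> ends exactly where the curve meets the
        line of slope \<open>r_seq i\<close>.\<close>
      have "curved_value i l \<le> r_seq i * l"
        using i False i4 r[OF i4] assms
        by (intro curved_value_le) (auto simp: curved_range_def r_quot_def)
      also have "\<dots> \<le> 22 / 25 * l"
        using r(1)[OF i4] assms by (intro mult_right_mono) auto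
      finally show ?thesis
        using zeta_II_curved[OF i] by simp
    qed
  qed
  then show ?thesis using that by blast
qed

text \<open>Completing the square puts \<open>m\<close> strictly between the two roots that bound
  region V. A strict upper bound on a square is positive, which forces
  \<open>l > 16 * pi\<close>.\<close>

lemma LM_V_I:
  assumes "0 < l" "4 * pi * l < m * (l - m)"
  shows "(l, m) \<in> LM_V"
proof -
  have sq: "(2 * m - l)\<^sup>2 < l * (l - 16 * pi)"
    using assms(2) by (simp add: power2_eq_square algebra_simps)
  then have "0 < l * (l - 16 * pi)"
    by (rule le_less_trans[OF zero_le_power2])
  then have "l > 16 * pi"
    using \<open>0 < l\<close> by (simp add: zero_less_mult_iff)
  moreover have "\<bar>2 * m - l\<bar> < sqrt (l * (l - 16 * pi))"
    using sq by (intro real_less_rsqrt) simp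
  ultimately show ?thesis
    by (auto simp: LM_V_def)
qed

text \<open>As a function of \<open>m\<close>, the product \<open>m * (l - m)\<close> is concave and
  symmetric about \<open>l / 2\<close>, so on \<open>[c, l - c]\<close> it is least at the
  endpoints.\<close>

lemma LM_V_strip:
  assumes "c \<le> m" "m \<le> l - c" "0 < l" "4 * pi * l < c * (l - c)"
  shows "(l, m) \<in> LM_V"
proof (rule LM_V_I)
  have "0 \<le> (m - c) * (l - c - m)"
    using assms by simp
  then show "4 * pi * l < m * (l - m)"
    using assms(4) by (simp add: algebra_simps)
qed fact

lemma LM_upper_in_theory:
  assumes "0 < l" "22 / 25 * l < m" "m < l"
  shows "(l, m) \<in> LM_II \<union> LM_V"
  using \<open>0 < l\<close>
proof (cases rule: zeta_II_cases)
  case 1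
  then show ?thesis using assms by (auto simp: LM_II_def)
next
  case 2
  show ?thesis
  proof (cases "m \<le> l - 143 / 10")
    case True
    \<comment> \<open>Since 14.3 - 4 * pi > 1.7, already \<open>l \<ge> 122\<close> gives (14.3 - 4
      * pi) * l > 14.3 * 14.3.\<close>
    have "pi * l \<le> 314159266 / 100000000 * l"
      using pi_approx 2 by (intro mult_right_mono) auto
    then have "4 * pi * l < 143 / 10 * (l - 143 / 10)"
      using 2 by (simp only: mult.assoc right_diff_distrib)
    then have "(l, m) \<in> LM_V"
      using assms 2 True by (intro LM_V_strip[of "143 / 10"]) auto
    then show ?thesis ..
  next
    case False
    then show ?thesis
      using curved_value_5_less[of l] 2 assms by (auto simp: LM_II_def)
  qed
qed

lemma LM_lower_in_theory:
  assumes "150 < l" "0 < m" "m \<le> 22 / 25 * l"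
  shows "(l, m) \<in> LM_III \<union> LM_IV \<union> LM_V"
proof -
  \<comment> \<open>Regions III, IV and V in turn: 64/225 is the lower edge of IV, and 14 is the
    value of its upper edge \<open>l / 10 - 1\<close> at \<open>l = 150\<close>.\<close>
  consider "m < 64 / 225" | "64 / 225 \<le> m" "m \<le> 14" | "14 < m" by linarith
  then show ?thesis
  proof cases
    case 1
    have "64 / 225 \<le> sqrt (l / 5 - 2)"
      using assms by (intro real_le_rsqrt) (simp add: power2_eq_square)
    then show ?thesis using 1 assms by (auto simp: LM_III_def)
  next
    case 2
    then show ?thesis using assms by (auto simp: LM_IV_def)
  next
    case 3
    have "pi * l \<le> 315 / 100 * l"
      using pi_approx assms by (intro mult_right_mono) auto
    then have "4 * pi * l < 14 * (l - 14)"
      using assms by (simp only: mult.assoc right_diff_distrib)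
    \<comment> \<open>The bound \<open>m \<le> l - 14\<close> holds because \<open>l - m\<close> is
      at least 3/25 of \<open>l\<close>, hence more than 18.\<close>
    then have "(l, m) \<in> LM_V"
      using assms 3 by (intro LM_V_strip[of 14]) auto
    then show ?thesis ..
  qed
qed

theorem theorem8p1:
  shows "bounded (LM - LM_theory) \<and> LM - LM_theory \<subseteq> LM_comp"
proof -
  have sub: "LM - LM_theory \<subseteq> LM_comp"
  proof (rule subrelI)
    fix l m assume "(l, m) \<in> LM - LM_theory"
    then have m: "0 < m" "m < l" and out: "(l, m) \<notin> LM_theory"
      by (auto simp: LM_def)
    have "5 / 2 \<le> l"
    proof (rule ccontr)
      assume "\<not> 5 / 2 \<le> l"
      \<comment> \<open>This makes \<open>2 * sqrt 2\<close> at least 5/2, so the point lies in the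
        triangular part of region I.\<close>
      moreover have "5 / 4 \<le> sqrt (2 :: real)"
        by (rule real_le_rsqrt) (simp add: power2_eq_square)
      ultimately have "(l, m) \<in> LM_I"
        using m by (auto simp: LM_I_def)
      then show False using out by (simp add: LM_theory_def)
    qed
    moreover have "m \<le> 22 / 25 * l"
      using LM_upper_in_theory[of l m] m out by (force simp: LM_theory_def)
    moreover from this have "l \<le> 150"
      using LM_lower_in_theory[of l m] m out by (force simp: LM_theory_def)
    ultimately show "(l, m) \<in> LM_comp"
      using m by (simp add: LM_comp_def)
  qed
  \<comment> \<open>132 is 22/25 of 150.\<close>
  have "LM_comp \<subseteq> {5 / 2..150} \<times> {0..132}"
    by (auto simp: LM_comp_def)
  then have "bounded LM_comp"
    by (rule bounded_subset[rotated]) (intro bounded_Times bounded_closed_interval)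
  then show ?thesis
    using sub bounded_subset by blast
qed

end
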